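(* Let $b\in\mathbb{R}$ and $\varGamma=(1+|x|^2/\eta)^{b/2}$ where $\eta\ge1$, $x\in\mathbb{R}^n$. Then $$\eta^{-b_+/2}\langle x\rangle^b\le\varGamma\le\eta^{-b_-/2}\langle x\rangle^b,$$ where $b_+=\max\{b,0\}$ and $b_-=\min\{b,0\}$.
   Context: Notation: $\langle x\rangle=(1+|x|^2)^{1/2}$ for $x\in\mathbb{R}^n$. *)

theory Defs
  imports "HOL-Analysis.Analysis"
begin

definition japanese_bracket :: "real ^ 'n \<Rightarrow> real" where
  "japanese_bracket x = (1 + (norm x)\<^sup>2) powr (1/2)"

definition pos_part :: "real \<Rightarrow> real" where
  "pos_part b = max b 0"

text \<open>The negative part is taken with its sign, so it is always non-positive.\<close>

definition neg_part :: "real \<Rightarrow> real" where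
  "neg_part b = min b 0"

definition Gamma_weight :: "real \<Rightarrow> real \<Rightarrow> real ^ 'n \<Rightarrow> real" where
  "Gamma_weight b \<eta> x = (1 + (norm x)\<^sup>2 / \<eta>) powr (b / 2)"

end

theory Submission
  imports Defs
begin

text \<open>With \<open>J = 1 + |x|\<^sup>2\<close> and \<open>G = 1 + |x|\<^sup>2 / \<eta>\<close> we have \<open>J / \<eta> \<le> G \<le> J\<close>. Both bounds follow by
  raising this to the power \<open>b / 2\<close>, which preserves or reverses the order according to the sign
  of \<open>b\<close>.\<close>

theorem lemma3p1:
  fixes b \<eta> :: real and x :: "real ^ 'n"
  assumes "\<eta> \<ge> 1"
  shows "\<eta> powr (- pos_part b / 2) * japanese_bracket x powr b \<le> Gamma_weight b \<eta> x
    \<and> Gamma_weight b \<eta> x \<le> \<eta> powr (- neg_part b / 2) * japanese_bracket x powr b"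
proof -
  define J where "J = 1 + (norm x)\<^sup>2"
  define G where "G = 1 + (norm x)\<^sup>2 / \<eta>"
  have J: "J > 0" and G: "G > 0"
    using assms by (auto simp: J_def G_def intro!: add_pos_nonneg)
  \<comment> \<open>\<open>J / \<eta>\<close> and \<open>G\<close> differ only in the constant term,
    \<open>1 / \<eta>\<close> against 1; \<open>G\<close> and \<open>J\<close> only in the quadratic
    term.\<close>
  have lower: "J / \<eta> \<le> G" and upper: "G \<le> J"
    using assms by (auto simp: J_def G_def field_simps mult_le_cancel_right1)
  have pos: "J / \<eta> > 0"
    using J assms by simp
  have bracket: "japanese_bracket x powr b = J powr (b / 2)"
    by (simp add: japanese_bracket_def J_def powr_powr)
  have scaled: "(J / \<eta>) powr (b / 2) = \<eta> powr (- b / 2) * J powr (b / 2)"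
    using J assms by (simp add: powr_divide powr_minus_divide)
  have weight: "Gamma_weight b \<eta> x = G powr (b / 2)"
    by (simp add: Gamma_weight_def G_def)
  show ?thesis
  proof (cases "b \<ge> 0")
    case True
    \<comment> \<open>Here \<open>neg_part b = 0\<close>, so the upper factor is
      \<open>\<eta> powr 0 = 1\<close>; \<open>scaled\<close> supplies the lower one.\<close>
    then have "(J / \<eta>) powr (b / 2) \<le> G powr (b / 2)" "G powr (b / 2) \<le> J powr (b / 2)"
      using lower upper pos G by (auto intro!: powr_mono2)
    then show ?thesis
      using True assms unfolding scaled by (simp add: bracket weight pos_part_def neg_part_def)
  next
    case False
    \<comment> \<open>The negative exponent swaps the roles: \<open>J\<close> now bounds from below
      with factor 1, \<open>J / \<eta>\<close> from above.\<close>
    then have "J powr (b / 2) \<le> G powr (b / 2)" "G powr (b / 2) \<le> (J / \<eta>) powr (b / 2)"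
      using lower upper pos G by (auto intro!: powr_mono2')
    then show ?thesis
      using False assms unfolding scaled by (simp add: bracket weight pos_part_def neg_part_def)
  qed
qed

end
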